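(* Let $K$ be any non-empty set and let $\mathbb{X}$ be a Banach space over $\mathbb{K}\in\{\mathbb{R},\mathbb{C}\}$. Let $f \in \ell_{\infty}(K,\mathbb{X})$ with $\|f\|=1$. Then $f$ is left symmetric in $\ell_{\infty}(K,\mathbb{X})$ if and only if both of the following hold: (i) there exists $k_0 \in K$ such that $\|f(k_0)\|=1$ and $f(k)=0$ for all $k \in K$ with $k\neq k_0$; (ii) $f(k_0)$ is a left symmetric point of $\mathbb{X}$.
   Context: $\ell_{\infty}(K,\mathbb{X})$ is the Banach space of all bounded functions $f:K\to\mathbb{X}$ with norm $\|f\|=\sup_{k\in K}\|f(k)\|$. For a Banach space $\mathbb{Z}$ over $\mathbb{K}$ and $x,y\in\mathbb{Z}$, $x$ is Birkhoff-James orthogonal to $y$, written $x\perp_B y$, if $\|x+\lambda y\|\ge\|x\|$ for all $\lambda\in\mathbb{K}$. A point $x\in\mathbb{Z}$ is left symmetric (in $\mathbb{Z}$) if for all $y\in\mathbb{Z}$, $x\perp_B y$ implies $y\perp_B x$. *)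

theory Defs
  imports "HOL-Analysis.Analysis" "HOL-Probability.Discrete_Topology"
begin

text \<open>Complex normed spaces. The underlying real structure is that of
  \<^class>\<open>real_normed_vector\<close>, obtained from the complex one by restriction of scalars.\<close>

class complex_normed_vector = real_normed_vector +
  fixes scaleC :: "complex \<Rightarrow> 'a \<Rightarrow> 'a"  (infixr \<open>*\<^sub>C\<close> 75)
  assumes scaleC_add_right: "a *\<^sub>C (x + y) = a *\<^sub>C x + a *\<^sub>C y"
    and scaleC_add_left: "(a + b) *\<^sub>C x = a *\<^sub>C x + b *\<^sub>C x"
    and scaleC_scaleC: "a *\<^sub>C (b *\<^sub>C x) = (a * b) *\<^sub>C x"
    and scaleR_scaleC: "r *\<^sub>R x = complex_of_real r *\<^sub>C x"
    and norm_scaleC: "norm (a *\<^sub>C x) = cmod a * norm x"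

class complex_banach = complex_normed_vector + banach

instantiation complex :: complex_banach
begin

definition scaleC_complex :: "complex \<Rightarrow> complex \<Rightarrow> complex"
  where "scaleC_complex a x = a * x"

instance
  by standard (auto simp: scaleC_complex_def algebra_simps norm_mult scaleR_conv_of_real)

end


text \<open>The bounded functions on a set are its bounded continuous functions for the discrete
  topology. The index set is the type \<^typ>\<open>'k discrete\<close>, a copy of \<^typ>\<open>'k\<close>; the two
  lemmas check that all bounded functions occur, and that the norm is the supremum norm.\<close>

type_synonym ('k, 'x) linf = "'k discrete \<Rightarrow>\<^sub>C 'x"

instance bcontfun :: (metric_space, banach) banach ..

lemma bounded_imp_linf:
  fixes f :: "'k discrete \<Rightarrow> 'x::real_normed_vector"
  assumes "bounded (range f)"
  obtains F :: "('k, 'x) linf" where "apply_bcontfun F = f"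
proof -
  have "f \<in> bcontfun"
    using assms by (auto simp: bcontfun_def continuous_on_open_vimage open_discrete)
  then show thesis
    using that bcontfunE by metis
qed

lemma norm_linf:
  fixes f :: "('k, 'x::real_normed_vector) linf"
  shows "norm f = (SUP k. norm (f k))"
  by (simp add: norm_bcontfun_def dist_bcontfun.rep_eq)

instantiation bcontfun :: (topological_space, complex_normed_vector) complex_normed_vector
begin

lemma continuous_on_scaleC:
  fixes f :: "'c::topological_space \<Rightarrow> 'd::complex_normed_vector"
  assumes "continuous_on S f"
  shows "continuous_on S (\<lambda>x. c *\<^sub>C f x)"
proof -
  have "bounded_linear (\<lambda>x::'d. c *\<^sub>C x)"
  proof (rule bounded_linear_intro[where K = "cmod c"])
    show "c *\<^sub>C (r *\<^sub>R x) = r *\<^sub>R (c *\<^sub>C x)" for r and x :: 'd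
      by (simp add: scaleR_scaleC scaleC_scaleC mult.commute)
  qed (simp_all add: scaleC_add_right norm_scaleC mult.commute)
  then show ?thesis
    using assms by (rule bounded_linear.continuous_on)
qed

definition scaleC_bcontfun :: "complex \<Rightarrow> ('a \<Rightarrow>\<^sub>C 'b) \<Rightarrow> 'a \<Rightarrow>\<^sub>C 'b"
  where "scaleC_bcontfun c f = Bcontfun (\<lambda>x. c *\<^sub>C f x)"

lemma apply_bcontfun_scaleC [simp]: "apply_bcontfun (c *\<^sub>C f) x = c *\<^sub>C f x"
  for f :: "'a \<Rightarrow>\<^sub>C 'b"
proof -
  have "norm (c *\<^sub>C f y) \<le> cmod c * norm f" for y
    by (simp add: norm_scaleC norm_bounded mult_left_mono)
  then have "(\<lambda>x. c *\<^sub>C f x) \<in> bcontfun"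
    by (intro bcontfun_normI continuous_on_scaleC) auto
  then show ?thesis
    by (simp add: scaleC_bcontfun_def Bcontfun_inverse)
qed

instance
proof
  fix a b :: complex and r :: real and f g :: "'a \<Rightarrow>\<^sub>C 'b"
  show "a *\<^sub>C (f + g) = a *\<^sub>C f + a *\<^sub>C g"
    by (rule bcontfun_eqI) (simp add: scaleC_add_right)
  show "(a + b) *\<^sub>C f = a *\<^sub>C f + b *\<^sub>C f"
    by (rule bcontfun_eqI) (simp add: scaleC_add_left)
  show "a *\<^sub>C b *\<^sub>C f = (a * b) *\<^sub>C f"
    by (rule bcontfun_eqI) (simp add: scaleC_scaleC)
  show "r *\<^sub>R f = complex_of_real r *\<^sub>C f"
    by (rule bcontfun_eqI) (simp add: scaleR_scaleC)
  have "norm h = (SUP x. norm (h x))" for h :: "'a \<Rightarrow>\<^sub>C 'b"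
    by (simp add: norm_bcontfun_def dist_bcontfun.rep_eq)
  then have "norm (a *\<^sub>C f) = norm (cmod a *\<^sub>R f)"
    by (simp add: norm_scaleC)
  then show "norm (a *\<^sub>C f) = cmod a * norm f"
    by simp
qed

end

instance bcontfun :: (metric_space, complex_banach) complex_banach ..


text \<open>The first argument is the scalar multiplication of the space, \<^const>\<open>scaleR\<close> or
  \<^const>\<open>scaleC\<close>; its type fixes the field that the scalar ranges over.\<close>

definition birkhoff_james_orthogonal ::
    "('s \<Rightarrow> 'z \<Rightarrow> 'z) \<Rightarrow> 'z::real_normed_vector \<Rightarrow> 'z \<Rightarrow> bool"
  where "birkhoff_james_orthogonal mul x y \<longleftrightarrow> (\<forall>c. norm (x + mul c y) \<ge> norm x)"

definition left_symmetric :: "('s \<Rightarrow> 'z \<Rightarrow> 'z) \<Rightarrow> 'z::real_normed_vector \<Rightarrow> bool"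
  where "left_symmetric mul x \<longleftrightarrow>
    (\<forall>y. birkhoff_james_orthogonal mul x y \<longrightarrow> birkhoff_james_orthogonal mul y x)"

end

theory Submission
  imports Defs
begin

text \<open>If \<open>f\<close> is supported at one point \<open>k\<close>, then small multiples of any \<open>h\<close> are invisible off
  \<open>k\<close>, and by convexity orthogonality need only be tested on small scalars; so \<open>f \<bottom> h\<close> gives
  \<open>f k \<bottom> h k\<close>. In general, let \<open>f k \<noteq> 0\<close> and let \<open>h\<close> be the restriction of \<open>f\<close> to \<open>{k}\<close>. By the
  above \<open>h\<close> is not orthogonal to \<open>f\<close>. If \<open>f\<close> is left symmetric, then \<open>f\<close> is not orthogonal to
  \<open>h\<close> either, so \<open>\<parallel>f + c h\<parallel> < \<parallel>f\<parallel>\<close> for some \<open>c\<close>, which bounds \<open>f\<close> off \<open>k\<close> strictly below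
  \<open>\<parallel>f\<parallel>\<close>. This cannot happen at two distinct points \<open>k\<close>.\<close>

text \<open>The scalar field stays abstract so that one proof serves \<open>scaleR\<close> and
  \<open>scaleC\<close>. The last two laws tie real scalars to \<open>scaleR\<close>, as convex
  combinations require.\<close>

locale normed_scalar_mult =
  fixes mul :: "'s::real_normed_algebra_1 \<Rightarrow> 'x::real_normed_vector \<Rightarrow> 'x"
  assumes norm_mul: "norm (mul c x) = norm c * norm x"
    and mul_of_real: "mul (of_real r) x = r *\<^sub>R x"
    and mul_of_real_mult: "mul (of_real r * c) x = r *\<^sub>R mul c x"
begin

lemma mul_zero_right [simp]: "mul c 0 = 0"
  using norm_mul[of c 0] by simp

text \<open>A scalar \<open>c\<close> that makes \<open>x + mul c y\<close> shorter than
  \<open>x\<close> can be shrunk: for 0 < t < 1 the vector \<open>x + mul (of_real t * c) y\<close>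
  is a convex combination of \<open>x\<close> and \<open>x + mul c y\<close>, hence still shorter
  than \<open>x\<close>.\<close>

lemma birkhoff_james_orthogonal_local:
  assumes "d > 0" and small: "\<And>c. norm c < d \<Longrightarrow> norm (x + mul c y) \<ge> norm x"
  shows "birkhoff_james_orthogonal mul x y"
  unfolding birkhoff_james_orthogonal_def
proof (rule ccontr)
  assume "\<not> (\<forall>c. norm x \<le> norm (x + mul c y))"
  then obtain c where c: "norm (x + mul c y) < norm x"
    by (auto simp: not_le)
  \<comment> \<open>Small enough for \<open>t * norm c < d\<close>; the 1 in the denominator gives
    \<open>t < 1\<close> whatever \<open>c\<close> is.\<close>
  define t where "t = d / (d + norm c + 1)"
  have pos: "0 < d + norm c + 1"
    using \<open>d > 0\<close> norm_ge_zero[of c] by linarith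
  have t: "0 < t" "t < 1"
    using \<open>d > 0\<close> pos by (simp_all add: t_def add_nonneg_pos)
  have "d * norm c < d * (d + norm c + 1)"
    using \<open>d > 0\<close> by (intro mult_strict_left_mono) simp_all
  then have tc: "t * norm c < d"
    using pos by (simp add: t_def pos_divide_less_eq)
  have "x + mul (of_real t * c) y = (1 - t) *\<^sub>R x + t *\<^sub>R (x + mul c y)"
    by (simp add: mul_of_real_mult algebra_simps)
  then have "norm (x + mul (of_real t * c) y)
      \<le> norm ((1 - t) *\<^sub>R x) + norm (t *\<^sub>R (x + mul c y))"
    by (simp only: norm_triangle_ineq)
  also have "\<dots> = (1 - t) * norm x + t * norm (x + mul c y)"
    using t by simp
  also have "\<dots> < (1 - t) * norm x + t * norm x"
    using c t by simp
  finally have "norm (x + mul (of_real t * c) y) < norm x"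
    by (simp add: algebra_simps)
  moreover have "norm (of_real t * c) < d"
    using norm_mult_ineq[of "of_real t" c] t tc by simp
  ultimately show False
    using small[of "of_real t * c"] by simp
qed

end

definition point_linf :: "'k discrete \<Rightarrow> 'x::real_normed_vector \<Rightarrow> ('k, 'x) linf"
  where "point_linf k0 x = Bcontfun (\<lambda>k. if k = k0 then x else 0)"

lemma point_linf_apply:
  fixes x :: "'x::real_normed_vector" and k0 :: "'k discrete"
  shows "point_linf k0 x k = (if k = k0 then x else 0)"
proof -
  have "bounded (range (\<lambda>k. if k = k0 then x else 0))"
    by (rule boundedI[where B = "norm x"]) auto
  then obtain F :: "('k, 'x) linf" where F: "apply_bcontfun F = (\<lambda>k. if k = k0 then x else 0)"
    by (rule bounded_imp_linf)
  have "point_linf k0 x = F"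
    unfolding point_linf_def F[symmetric] by (rule apply_bcontfun_inverse)
  then show ?thesis
    by (simp add: F)
qed

lemma norm_point_linf: "norm (point_linf k0 x) = norm x"
proof (rule antisym)
  show "norm (point_linf k0 x) \<le> norm x"
    by (rule norm_bound) (simp add: point_linf_apply)
  show "norm x \<le> norm (point_linf k0 x)"
    using norm_bounded[of "point_linf k0 x" k0] by (simp add: point_linf_apply)
qed

lemma eq_point_linf:
  fixes f :: "('k, 'x::real_normed_vector) linf"
  assumes "\<And>k. k \<noteq> k0 \<Longrightarrow> f k = 0"
  shows "f = point_linf k0 (f k0)"
  by (rule bcontfun_eqI) (simp add: point_linf_apply assms)

locale linf_scalar_mult = normed_scalar_mult mul
  for mul :: "'s::real_normed_algebra_1 \<Rightarrow> 'x::real_normed_vector \<Rightarrow> 'x" +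
  fixes mulF :: "'s \<Rightarrow> ('k, 'x) linf \<Rightarrow> ('k, 'x) linf"
  assumes mulF_apply [simp]: "mulF c f k = mul c (f k)"
begin

lemma add_mul_point_linf:
  "point_linf k x + mulF c (point_linf k y) = point_linf k (x + mul c y)"
  by (rule bcontfun_eqI) (simp add: point_linf_apply)

lemma point_linf_orthogonal_iff:
  "birkhoff_james_orthogonal mulF (point_linf k x) (point_linf k y)
    \<longleftrightarrow> birkhoff_james_orthogonal mul x y"
  by (simp add: birkhoff_james_orthogonal_def add_mul_point_linf norm_point_linf)

text \<open>For small \<open>c\<close> the sum stays below \<open>norm x\<close> away from
  \<open>k0\<close>, so its supremum norm can reach \<open>norm x\<close> only through its value at
  \<open>k0\<close>.\<close>

lemma orthogonal_at_support:
  assumes orth: "birkhoff_james_orthogonal mulF (point_linf k0 x) h"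
  shows "birkhoff_james_orthogonal mul x (h k0)"
proof (cases "x = 0")
  case True
  then show ?thesis
    by (simp add: birkhoff_james_orthogonal_def)
next
  case False
  \<comment> \<open>Then \<open>norm c < d\<close> forces \<open>norm c * norm h < norm x\<close>;
    the 1 covers \<open>h = 0\<close>.\<close>
  define d where "d = norm x / (norm h + 1)"
  show ?thesis
  proof (rule birkhoff_james_orthogonal_local[of d])
    show "d > 0"
      using False by (simp add: d_def add_nonneg_pos)
    fix c :: 's
    assume "norm c < d"
    then have "norm c * (norm h + 1) < norm x"
      by (simp add: d_def pos_less_divide_eq add_nonneg_pos)
    then have c: "norm c * norm h < norm x"
      using norm_ge_zero[of c] unfolding distrib_left by linarith
    show "norm x \<le> norm (x + mul c (h k0))"
    proof (rule ccontr)
      assume "\<not> norm x \<le> norm (x + mul c (h k0))"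
      \<comment> \<open>A supremum of values below \<open>norm x\<close> may equal
        \<open>norm x\<close>, so one uniform bound strictly below it is used.\<close>
      then have less: "max (norm (x + mul c (h k0))) (norm c * norm h) < norm x"
        using c by simp
      have "norm ((point_linf k0 x + mulF c h) k)
          \<le> max (norm (x + mul c (h k0))) (norm c * norm h)" for k
        by (cases "k = k0")
          (simp_all add: point_linf_apply norm_mul le_max_iff_disj norm_bounded mult_left_mono)
      then have "norm (point_linf k0 x + mulF c h)
          \<le> max (norm (x + mul c (h k0))) (norm c * norm h)"
        by (rule norm_bound)
      also note less
      also have "norm x = norm (point_linf k0 x)"
        by (simp only: norm_point_linf)
      finally show False
        using orth by (auto simp: birkhoff_james_orthogonal_def not_less[symmetric])
    qed
  qed
qed

text \<open>Forwards, \<open>point_linf k0\<close> is an isometric embedding that preserves and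
  reflects orthogonality. Backwards, symmetry at \<open>x\<close> makes \<open>h k0\<close>
  orthogonal to \<open>x\<close>, and adding multiples of \<open>point_linf k0 x\<close> alters
  \<open>h\<close> at \<open>k0\<close> only.\<close>

lemma left_symmetric_point_linf:
  "left_symmetric mulF (point_linf k0 x) \<longleftrightarrow> left_symmetric mul x"
proof
  assume "left_symmetric mulF (point_linf k0 x)"
  then show "left_symmetric mul x"
    unfolding left_symmetric_def by (auto simp flip: point_linf_orthogonal_iff[of k0])
next
  assume sym: "left_symmetric mul x"
  show "left_symmetric mulF (point_linf k0 x)"
    unfolding left_symmetric_def
  proof (intro allI impI)
    fix h
    assume "birkhoff_james_orthogonal mulF (point_linf k0 x) h"
    then have orth: "birkhoff_james_orthogonal mul (h k0) x"
      using sym orthogonal_at_support by (auto simp: left_symmetric_def)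
    show "birkhoff_james_orthogonal mulF h (point_linf k0 x)"
      unfolding birkhoff_james_orthogonal_def
    proof
      fix c
      let ?s = "h + mulF c (point_linf k0 x)"
      show "norm h \<le> norm ?s"
      proof (rule norm_bound)
        fix k
        have "norm (h k) \<le> norm (?s k)"
          using orth by (simp add: point_linf_apply birkhoff_james_orthogonal_def)
        then show "norm (h k) \<le> norm ?s"
          using norm_bounded[of ?s k] by (rule order_trans)
      qed
    qed
  qed
qed

text \<open>Otherwise the nonzero vector \<open>f k0\<close> would be orthogonal to itself, which
  the scalar -1 refutes.\<close>

lemma point_linf_not_orthogonal:
  fixes f :: "('k, 'x) linf"
  assumes "f k0 \<noteq> 0"
  shows "\<not> birkhoff_james_orthogonal mulF (point_linf k0 (f k0)) f"
proof
  assume orth: "birkhoff_james_orthogonal mulF (point_linf k0 (f k0)) f"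
  have "birkhoff_james_orthogonal mul (f k0) (f k0)"
    using orthogonal_at_support[OF orth] .
  then have "norm (f k0) \<le> norm (f k0 + mul (of_real (-1)) (f k0))"
    unfolding birkhoff_james_orthogonal_def by blast
  with assms show False
    by (simp only: mul_of_real) simp
qed

text \<open>The bound \<open>r\<close> is the norm of a perturbation of \<open>f\<close> at
  \<open>k0\<close> that is shorter than \<open>f\<close>; off \<open>k0\<close> the perturbation
  agrees with \<open>f\<close>.\<close>

lemma left_symmetric_bound_off_point:
  fixes f :: "('k, 'x) linf"
  assumes "left_symmetric mulF f" and "f k0 \<noteq> 0"
  obtains r where "r < norm f" and "\<forall>k. k \<noteq> k0 \<longrightarrow> norm (f k) \<le> r"
proof -
  have "\<not> birkhoff_james_orthogonal mulF f (point_linf k0 (f k0))"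
    using assms point_linf_not_orthogonal by (auto simp: left_symmetric_def)
  then obtain c where c: "norm (f + mulF c (point_linf k0 (f k0))) < norm f"
    by (auto simp: birkhoff_james_orthogonal_def not_le)
  have "norm (f k) \<le> norm (f + mulF c (point_linf k0 (f k0)))" if "k \<noteq> k0" for k
    using norm_bounded[of "f + mulF c (point_linf k0 (f k0))" k] that
    by (simp add: point_linf_apply)
  with c show thesis
    using that by blast
qed

lemma left_symmetric_imp_point:
  fixes f :: "('k, 'x) linf"
  assumes sym: "left_symmetric mulF f" and "f \<noteq> 0"
  obtains k0 x where "f = point_linf k0 x"
proof -
  obtain k0 where k0: "f k0 \<noteq> 0"
    using \<open>f \<noteq> 0\<close> bcontfun_eqI[of f 0] by auto
  have "f k = 0" if "k \<noteq> k0" for k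
  proof (rule ccontr)
    assume k: "f k \<noteq> 0"
    obtain r where r: "r < norm f" and r_bound: "\<forall>j. j \<noteq> k0 \<longrightarrow> norm (f j) \<le> r"
      by (rule left_symmetric_bound_off_point[OF sym k0])
    obtain s where s: "s < norm f" and s_bound: "\<forall>j. j \<noteq> k \<longrightarrow> norm (f j) \<le> s"
      by (rule left_symmetric_bound_off_point[OF sym k])
    \<comment> \<open>As \<open>k\<close> and \<open>k0\<close> differ, \<open>s\<close> bounds the
      value at \<open>k0\<close> and \<open>r\<close> all the others.\<close>
    have "norm (f j) \<le> max r s" for j
      using r_bound s_bound \<open>k \<noteq> k0\<close> by (cases "j = k0") auto
    then have "norm f \<le> max r s"
      by (rule norm_bound)
    with r s show False
      by simp
  qed
  then have "f = point_linf k0 (f k0)"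
    by (rule eq_point_linf)
  then show thesis
    by (rule that)
qed

theorem left_symmetric_linf_iff:
  fixes f :: "('k, 'x) linf"
  assumes "norm f = 1"
  shows "left_symmetric mulF f \<longleftrightarrow>
    (\<exists>k0. (norm (f k0) = 1 \<and> (\<forall>k. k \<noteq> k0 \<longrightarrow> f k = 0)) \<and> left_symmetric mul (f k0))"
proof
  assume sym: "left_symmetric mulF f"
  moreover have "f \<noteq> 0"
    using assms by auto
  ultimately obtain k0 x where "f = point_linf k0 x"
    by (rule left_symmetric_imp_point)
  with assms sym
  have "(norm (f k0) = 1 \<and> (\<forall>k. k \<noteq> k0 \<longrightarrow> f k = 0)) \<and> left_symmetric mul (f k0)"
    by (simp add: point_linf_apply norm_point_linf left_symmetric_point_linf)
  then show "\<exists>k0. (norm (f k0) = 1 \<and> (\<forall>k. k \<noteq> k0 \<longrightarrow> f k = 0)) \<and> left_symmetric mul (f k0)"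
    by (rule exI)
next
  assume "\<exists>k0. (norm (f k0) = 1 \<and> (\<forall>k. k \<noteq> k0 \<longrightarrow> f k = 0)) \<and> left_symmetric mul (f k0)"
  then obtain k0 where "\<And>k. k \<noteq> k0 \<Longrightarrow> f k = 0" and sym: "left_symmetric mul (f k0)"
    by blast
  \<comment> \<open>Vanishing off \<open>k0\<close> puts \<open>f\<close> in the image of the
    embedding, where left symmetry is decided by \<open>f k0\<close>.\<close>
  from this(1) have "f = point_linf k0 (f k0)"
    by (rule eq_point_linf)
  then show "left_symmetric mulF f"
    by (rule ssubst) (simp add: sym left_symmetric_point_linf)
qed

end

interpretation real_linf: linf_scalar_mult
  "scaleR :: real \<Rightarrow> 'x::real_normed_vector \<Rightarrow> 'x"
  "scaleR :: real \<Rightarrow> ('k, 'x) linf \<Rightarrow> ('k, 'x) linf"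
  by standard simp_all

interpretation complex_linf: linf_scalar_mult
  "scaleC :: complex \<Rightarrow> 'y::complex_normed_vector \<Rightarrow> 'y"
  "scaleC :: complex \<Rightarrow> ('k, 'y) linf \<Rightarrow> ('k, 'y) linf"
  by standard (simp_all add: norm_scaleC scaleR_scaleC scaleC_scaleC)

theorem theorem3p1:
  fixes f :: "('k, 'x::banach) linf"
    and g :: "('k, 'y::complex_banach) linf"
  shows "(norm f = 1 \<longrightarrow>
      (left_symmetric scaleR f \<longleftrightarrow>
        (\<exists>k0. (norm (f k0) = 1 \<and> (\<forall>k. k \<noteq> k0 \<longrightarrow> f k = 0)) \<and> left_symmetric scaleR (f k0))))
    \<and> (norm g = 1 \<longrightarrow>
      (left_symmetric scaleC g \<longleftrightarrow>
        (\<exists>k0. (norm (g k0) = 1 \<and> (\<forall>k. k \<noteq> k0 \<longrightarrow> g k = 0)) \<and> left_symmetric scaleC (g k0))))"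
  by (intro conjI impI real_linf.left_symmetric_linf_iff complex_linf.left_symmetric_linf_iff)

end
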